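(* Let $\mathscr{C}$ be a monoidal category. There is an isomorphism between the category of classical monoids in $\mathscr{C}$ and the category of Saavedra monoids in $\mathscr{C}$.
   Context: A monoidal category is a category $\mathscr{C}$ with a strictly associative functor $\mathscr{C}\times\mathscr{C}\to\mathscr{C}$, written as juxtaposition (the identity arrow of an object $X$ is also written $X$), with an object $I$ and two corresponding unit structures: an LR unit structure, i.e. natural isomorphisms $\lambda_X: IX\to X$, $\rho_X: XI\to X$ satisfying $\lambda_I=\rho_I$, $\lambda_{XY}=\lambda_X Y$, $\rho_{XY}=X\rho_Y$, $X\lambda_Y=\rho_X Y$ for all $X,Y$; and the corresponding Saavedra unit structure $\alpha=\lambda_I=\rho_I:II\to I$. A semi-monoid is an object $M$ with an associative arrow $\mu:MM\to M$, i.e. $\mu\circ(\mu M)=\mu\circ(M\mu)$. A semi-monoid homomorphism $(M,\mu)\to(M',\mu')$ is an arrow $\psi:M\to M'$ with $\psi\circ\mu=\mu'\circ(\psi\psi)$. The pair $(I,\alpha)$ is a semi-monoid. A classical monoid is a semi-monoid $(M,\mu)$ with an arrow $\eta:I\to M$ such that $\mu\circ(\eta M)=\lambda_M$ and $\mu\circ(M\eta)=\rho_M$. For a semi-monoid $(M,\mu)$ and an object $U$, an arrow $g:U\to M$ is gentle if the composites $UM\xrightarrow{gM}MM\xrightarrow{\mu}M$ and $MU\xrightarrow{Mg}MM\xrightarrow{\mu}M$ are both monomorphisms. A Saavedra monoid is a semi-monoid $(M,\mu)$ with a gentle semi-monoid homomorphism $\eta:(I,\alpha)\to(M,\mu)$.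 In both categories, a homomorphism $(M,\mu,\eta)\to(M',\mu',\eta')$ is a semi-monoid homomorphism $\psi:M\to M'$ with $\psi\circ\eta=\eta'$. *)

theory Defs
  imports Main
begin

section \<open>Categories, functors, natural isomorphisms\<close>

record ('o, 'a) cat =
  Obj :: "'o set"
  Arr :: "'a set"
  Dom :: "'a \<Rightarrow> 'o"
  Cod :: "'a \<Rightarrow> 'o"
  Ident :: "'o \<Rightarrow> 'a"
  Comp :: "'a \<Rightarrow> 'a \<Rightarrow> 'a"  (infixr "\<cdot>\<index>" 55)

definition Hom :: "('o, 'a, 'm) cat_scheme \<Rightarrow> 'o \<Rightarrow> 'o \<Rightarrow> 'a set" where
  "Hom C X Y = {f \<in> Arr C. Dom C f = X \<and> Cod C f = Y}"

text \<open>Nothing is assumed about the values of the operations outside \<open>Obj\<close> and \<open>Arr\<close>, or about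
  non-composable pairs.\<close>

locale category =
  fixes C :: "('o, 'a, 'm) cat_scheme" (structure)
  assumes Dom_in: "f \<in> Arr C \<Longrightarrow> Dom C f \<in> Obj C"
    and Cod_in: "f \<in> Arr C \<Longrightarrow> Cod C f \<in> Obj C"
    and Ident_in: "X \<in> Obj C \<Longrightarrow> Ident C X \<in> Hom C X X"
    and Comp_in: "f \<in> Hom C X Y \<Longrightarrow> g \<in> Hom C Y Z \<Longrightarrow> g \<cdot> f \<in> Hom C X Z"
    and Ident_left: "f \<in> Hom C X Y \<Longrightarrow> Ident C Y \<cdot> f = f"
    and Ident_right: "f \<in> Hom C X Y \<Longrightarrow> f \<cdot> Ident C X = f"
    and Comp_assoc: "f \<in> Hom C W X \<Longrightarrow> g \<in> Hom C X Y \<Longrightarrow> h \<in> Hom C Y Z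
      \<Longrightarrow> (h \<cdot> g) \<cdot> f = h \<cdot> (g \<cdot> f)"

definition monomorphism :: "('o, 'a, 'm) cat_scheme \<Rightarrow> 'a \<Rightarrow> bool" where
  "monomorphism C f \<longleftrightarrow> f \<in> Arr C \<and>
    (\<forall>X. \<forall>g \<in> Hom C X (Dom C f). \<forall>h \<in> Hom C X (Dom C f).
      Comp C f g = Comp C f h \<longrightarrow> g = h)"

definition isomorphism :: "('o, 'a, 'm) cat_scheme \<Rightarrow> 'a \<Rightarrow> bool" where
  "isomorphism C f \<longleftrightarrow> f \<in> Arr C \<and>
    (\<exists>g \<in> Hom C (Cod C f) (Dom C f).
      Comp C g f = Ident C (Dom C f) \<and> Comp C f g = Ident C (Cod C f))"

definition product_category ::
  "('o, 'a, 'm) cat_scheme \<Rightarrow> ('p, 'b, 'n) cat_scheme \<Rightarrow> ('o \<times> 'p, 'a \<times> 'b) cat" where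
  "product_category C D = \<lparr>
     Obj = Obj C \<times> Obj D,
     Arr = Arr C \<times> Arr D,
     Dom = (\<lambda>(f, g). (Dom C f, Dom D g)),
     Cod = (\<lambda>(f, g). (Cod C f, Cod D g)),
     Ident = (\<lambda>(X, Y). (Ident C X, Ident D Y)),
     Comp = (\<lambda>(f', g') (f, g). (Comp C f' f, Comp D g' g)) \<rparr>"

record ('o, 'a, 'p, 'b) ftor =
  obj_map :: "'o \<Rightarrow> 'p"
  arr_map :: "'a \<Rightarrow> 'b"

locale cat_functor = dom: category C + cod: category D
  for C :: "('o, 'a, 'm) cat_scheme" and D :: "('p, 'b, 'n) cat_scheme" +
  fixes F :: "('o, 'a, 'p, 'b) ftor"
  assumes obj_map_in: "X \<in> Obj C \<Longrightarrow> obj_map F X \<in> Obj D"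
    and arr_map_in: "f \<in> Hom C X Y \<Longrightarrow> arr_map F f \<in> Hom D (obj_map F X) (obj_map F Y)"
    and arr_map_Ident: "X \<in> Obj C \<Longrightarrow> arr_map F (Ident C X) = Ident D (obj_map F X)"
    and arr_map_Comp: "f \<in> Hom C X Y \<Longrightarrow> g \<in> Hom C Y Z
      \<Longrightarrow> arr_map F (Comp C g f) = Comp D (arr_map F g) (arr_map F f)"

definition identity_functor :: "('o, 'a, 'o, 'a) ftor" where
  "identity_functor = \<lparr> obj_map = (\<lambda>X. X), arr_map = (\<lambda>f. f) \<rparr>"

locale natural_isomorphism = F: cat_functor C D F + G: cat_functor C D G
  for C :: "('o, 'a, 'm) cat_scheme" and D :: "('p, 'b, 'n) cat_scheme"
    and F :: "('o, 'a, 'p, 'b) ftor" and G :: "('o, 'a, 'p, 'b) ftor" +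
  fixes \<tau> :: "'o \<Rightarrow> 'b"
  assumes component_in: "X \<in> Obj C \<Longrightarrow> \<tau> X \<in> Hom D (obj_map F X) (obj_map G X)"
    and naturality: "f \<in> Hom C X Y
      \<Longrightarrow> Comp D (\<tau> Y) (arr_map F f) = Comp D (arr_map G f) (\<tau> X)"
    and component_iso: "X \<in> Obj C \<Longrightarrow> isomorphism D (\<tau> X)"

definition isomorphic_categories ::
  "('o, 'a, 'm) cat_scheme \<Rightarrow> ('p, 'b, 'n) cat_scheme \<Rightarrow> bool" where
  "isomorphic_categories C D \<longleftrightarrow>
    (\<exists>F G. cat_functor C D F \<and> cat_functor D C G \<and>
      (\<forall>X \<in> Obj C. obj_map G (obj_map F X) = X) \<and>
      (\<forall>f \<in> Arr C. arr_map G (arr_map F f) = f) \<and>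
      (\<forall>Y \<in> Obj D. obj_map F (obj_map G Y) = Y) \<and>
      (\<forall>g \<in> Arr D. arr_map F (arr_map G g) = g))"

section \<open>Monoidal categories\<close>

record ('o, 'a) moncat = "('o, 'a) cat" +
  Tensor :: "('o \<times> 'o, 'a \<times> 'a, 'o, 'a) ftor"
  Unit :: 'o
  Lam :: "'o \<Rightarrow> 'a"
  Rho :: "'o \<Rightarrow> 'a"

abbreviation tensor_obj ::
  "('o, 'a, 'm) moncat_scheme \<Rightarrow> 'o \<Rightarrow> 'o \<Rightarrow> 'o" (infixr "\<odot>\<index>" 70) where
  "tensor_obj C X Y \<equiv> obj_map (Tensor C) (X, Y)"

abbreviation tensor_arr ::
  "('o, 'a, 'm) moncat_scheme \<Rightarrow> 'a \<Rightarrow> 'a \<Rightarrow> 'a" (infixr "\<otimes>\<index>" 70) where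
  "tensor_arr C f g \<equiv> arr_map (Tensor C) (f, g)"

abbreviation whisker_right ::
  "('o, 'a, 'm) moncat_scheme \<Rightarrow> 'a \<Rightarrow> 'o \<Rightarrow> 'a" (infix "\<triangleleft>\<index>" 72) where
  "whisker_right C f X \<equiv> tensor_arr C f (Ident C X)"

abbreviation whisker_left ::
  "('o, 'a, 'm) moncat_scheme \<Rightarrow> 'o \<Rightarrow> 'a \<Rightarrow> 'a" (infix "\<triangleright>\<index>" 72) where
  "whisker_left C X f \<equiv> tensor_arr C (Ident C X) f"

definition tensor_left :: "('o, 'a, 'm) moncat_scheme \<Rightarrow> 'o \<Rightarrow> ('o, 'a, 'o, 'a) ftor" where
  "tensor_left C X = \<lparr> obj_map = tensor_obj C X, arr_map = whisker_left C X \<rparr>"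

definition tensor_right :: "('o, 'a, 'm) moncat_scheme \<Rightarrow> 'o \<Rightarrow> ('o, 'a, 'o, 'a) ftor" where
  "tensor_right C X =
    \<lparr> obj_map = (\<lambda>Y. tensor_obj C Y X), arr_map = (\<lambda>f. whisker_right C f X) \<rparr>"

text \<open>The tensor product is strictly associative on objects and on arrows, but the unit
  is not assumed to be strict.\<close>

locale monoidal_category = category C
  for C :: "('o, 'a, 'm) moncat_scheme" (structure) +
  assumes tensor_functor: "cat_functor (product_category C C) C (Tensor C)"
    and tensor_obj_assoc: "X \<in> Obj C \<Longrightarrow> Y \<in> Obj C \<Longrightarrow> Z \<in> Obj C
      \<Longrightarrow> (X \<odot> Y) \<odot> Z = X \<odot> (Y \<odot> Z)"
    and tensor_arr_assoc: "f \<in> Arr C \<Longrightarrow> g \<in> Arr C \<Longrightarrow> h \<in> Arr C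
      \<Longrightarrow> (f \<otimes> g) \<otimes> h = f \<otimes> (g \<otimes> h)"
    and Unit_in: "Unit C \<in> Obj C"
    and Lam_natural_iso:
      "natural_isomorphism C C (tensor_left C (Unit C)) identity_functor (Lam C)"
    and Rho_natural_iso:
      "natural_isomorphism C C (tensor_right C (Unit C)) identity_functor (Rho C)"
    and Lam_Rho_Unit: "Lam C (Unit C) = Rho C (Unit C)"
    and Lam_tensor: "X \<in> Obj C \<Longrightarrow> Y \<in> Obj C \<Longrightarrow> Lam C (X \<odot> Y) = Lam C X \<triangleleft> Y"
    and Rho_tensor: "X \<in> Obj C \<Longrightarrow> Y \<in> Obj C \<Longrightarrow> Rho C (X \<odot> Y) = X \<triangleright> Rho C Y"
    and Lam_Rho_middle: "X \<in> Obj C \<Longrightarrow> Y \<in> Obj C \<Longrightarrow> X \<triangleright> Lam C Y = Rho C X \<triangleleft> Y"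

definition saavedra_alpha :: "('o, 'a, 'm) moncat_scheme \<Rightarrow> 'a" where
  "saavedra_alpha C = Lam C (Unit C)"

section \<open>Semi-monoids and monoids\<close>

definition semi_monoid :: "('o, 'a, 'm) moncat_scheme \<Rightarrow> 'o \<Rightarrow> 'a \<Rightarrow> bool" where
  "semi_monoid C M \<mu> \<longleftrightarrow> M \<in> Obj C \<and> \<mu> \<in> Hom C (M \<odot>\<^bsub>C\<^esub> M) M \<and>
    \<mu> \<cdot>\<^bsub>C\<^esub> (\<mu> \<triangleleft>\<^bsub>C\<^esub> M) = \<mu> \<cdot>\<^bsub>C\<^esub> (M \<triangleright>\<^bsub>C\<^esub> \<mu>)"

definition semi_monoid_hom ::
  "('o, 'a, 'm) moncat_scheme \<Rightarrow> 'o \<Rightarrow> 'a \<Rightarrow> 'o \<Rightarrow> 'a \<Rightarrow> 'a \<Rightarrow> bool" where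
  "semi_monoid_hom C M \<mu> M' \<mu>' \<psi> \<longleftrightarrow>
    semi_monoid C M \<mu> \<and> semi_monoid C M' \<mu>' \<and> \<psi> \<in> Hom C M M' \<and>
    \<psi> \<cdot>\<^bsub>C\<^esub> \<mu> = \<mu>' \<cdot>\<^bsub>C\<^esub> (\<psi> \<otimes>\<^bsub>C\<^esub> \<psi>)"

definition classical_monoid ::
  "('o, 'a, 'm) moncat_scheme \<Rightarrow> 'o \<Rightarrow> 'a \<Rightarrow> 'a \<Rightarrow> bool" where
  "classical_monoid C M \<mu> \<eta> \<longleftrightarrow> semi_monoid C M \<mu> \<and> \<eta> \<in> Hom C (Unit C) M \<and>
    \<mu> \<cdot>\<^bsub>C\<^esub> (\<eta> \<triangleleft>\<^bsub>C\<^esub> M) = Lam C M \<and> \<mu> \<cdot>\<^bsub>C\<^esub> (M \<triangleright>\<^bsub>C\<^esub> \<eta>) = Rho C M"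

definition gentle ::
  "('o, 'a, 'm) moncat_scheme \<Rightarrow> 'o \<Rightarrow> 'a \<Rightarrow> 'o \<Rightarrow> 'a \<Rightarrow> bool" where
  "gentle C M \<mu> U g \<longleftrightarrow> U \<in> Obj C \<and> g \<in> Hom C U M \<and>
    monomorphism C (\<mu> \<cdot>\<^bsub>C\<^esub> (g \<triangleleft>\<^bsub>C\<^esub> M)) \<and> monomorphism C (\<mu> \<cdot>\<^bsub>C\<^esub> (M \<triangleright>\<^bsub>C\<^esub> g))"

definition saavedra_monoid ::
  "('o, 'a, 'm) moncat_scheme \<Rightarrow> 'o \<Rightarrow> 'a \<Rightarrow> 'a \<Rightarrow> bool" where
  "saavedra_monoid C M \<mu> \<eta> \<longleftrightarrow> semi_monoid C M \<mu> \<and>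
    semi_monoid_hom C (Unit C) (saavedra_alpha C) M \<mu> \<eta> \<and> gentle C M \<mu> (Unit C) \<eta>"

definition monoid_hom ::
  "('o, 'a, 'm) moncat_scheme \<Rightarrow> 'o \<times> 'a \<times> 'a \<Rightarrow> 'o \<times> 'a \<times> 'a \<Rightarrow> 'a \<Rightarrow> bool" where
  "monoid_hom C = (\<lambda>(M, \<mu>, \<eta>) (M', \<mu>', \<eta>') \<psi>.
    semi_monoid_hom C M \<mu> M' \<mu>' \<psi> \<and> \<psi> \<cdot>\<^bsub>C\<^esub> \<eta> = \<eta>')"

text \<open>Objects are triples \<open>(M, \<mu>, \<eta>)\<close>. An arrow carries its domain and codomain, since the same
  arrow of \<open>C\<close> may be a homomorphism between several pairs of monoids.\<close>

definition category_of_monoids ::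
  "('o, 'a, 'm) moncat_scheme \<Rightarrow> ('o \<times> 'a \<times> 'a) set \<Rightarrow>
    ('o \<times> 'a \<times> 'a, ('o \<times> 'a \<times> 'a) \<times> 'a \<times> ('o \<times> 'a \<times> 'a)) cat" where
  "category_of_monoids C \<M> = \<lparr>
     Obj = \<M>,
     Arr = {(A, \<psi>, B). A \<in> \<M> \<and> B \<in> \<M> \<and> monoid_hom C A B \<psi>},
     Dom = (\<lambda>(A, \<psi>, B). A),
     Cod = (\<lambda>(A, \<psi>, B). B),
     Ident = (\<lambda>(M, \<mu>, \<eta>). ((M, \<mu>, \<eta>), Ident C M, (M, \<mu>, \<eta>))),
     Comp = (\<lambda>(B', \<psi>, D) (A, \<phi>, B). (A, \<psi> \<cdot>\<^bsub>C\<^esub> \<phi>, D)) \<rparr>"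

definition classical_monoids ::
  "('o, 'a, 'm) moncat_scheme \<Rightarrow>
    ('o \<times> 'a \<times> 'a, ('o \<times> 'a \<times> 'a) \<times> 'a \<times> ('o \<times> 'a \<times> 'a)) cat" where
  "classical_monoids C = category_of_monoids C {(M, \<mu>, \<eta>). classical_monoid C M \<mu> \<eta>}"

definition saavedra_monoids ::
  "('o, 'a, 'm) moncat_scheme \<Rightarrow>
    ('o \<times> 'a \<times> 'a, ('o \<times> 'a \<times> 'a) \<times> 'a \<times> ('o \<times> 'a \<times> 'a)) cat" where
  "saavedra_monoids C = category_of_monoids C {(M, \<mu>, \<eta>). saavedra_monoid C M \<mu> \<eta>}"

lemma (in monoidal_category) semi_monoid_Unit: "semi_monoid C (Unit C) (saavedra_alpha C)"
proof -
  have "Lam C (Unit C) \<in> Hom C (Unit C \<odot> Unit C) (Unit C)"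
    using natural_isomorphism.component_in[OF Lam_natural_iso Unit_in]
    by (simp add: tensor_left_def identity_functor_def)
  moreover have "Lam C (Unit C) \<triangleleft> Unit C = Unit C \<triangleright> Lam C (Unit C)"
    using Lam_Rho_middle[OF Unit_in Unit_in] Lam_Rho_Unit by simp
  ultimately show ?thesis
    using Unit_in by (simp add: semi_monoid_def saavedra_alpha_def)
qed

end

theory Submission imports Defs begin

text \<open>The two categories are equal, because the two conditions on \<open>(M, \<mu>, \<eta>)\<close> are equivalent.
  For a Saavedra monoid put \<open>f = \<mu> \<circ> (\<eta> M)\<close>. Associativity and \<open>\<eta> \<circ> \<alpha> = \<mu> \<circ> (\<eta> \<eta>)\<close> give
  \<open>f \<circ> (I f) = f \<circ> (\<alpha> M) = f \<circ> (I \<lambda>\<^sub>M)\<close>, so \<open>I f = I \<lambda>\<^sub>M\<close> because \<open>f\<close> is monic. Naturality of \<open>\<lambda>\<close>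
  turns this into \<open>f \<circ> \<lambda>\<^bsub>IM\<^esub> = \<lambda>\<^sub>M \<circ> \<lambda>\<^bsub>IM\<^esub>\<close>, and \<open>\<lambda>\<^bsub>IM\<^esub>\<close> is invertible. Conversely, in a classical
  monoid \<open>\<mu> \<circ> (\<eta> M)\<close> and \<open>\<mu> \<circ> (M \<eta>)\<close> are invertible, hence monic.\<close>

section \<open>Cancellation of monic and invertible arrows\<close>

lemma HomD: "f \<in> Hom C X Y \<Longrightarrow> f \<in> Arr C \<and> Dom C f = X \<and> Cod C f = Y"
  by (simp add: Hom_def)

lemma monomorphism_cancel:
  "monomorphism C f \<Longrightarrow> f \<in> Hom C X Y \<Longrightarrow> g \<in> Hom C W X \<Longrightarrow> h \<in> Hom C W X
    \<Longrightarrow> f \<cdot>\<^bsub>C\<^esub> g = f \<cdot>\<^bsub>C\<^esub> h \<Longrightarrow> g = h"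
  unfolding monomorphism_def using HomD[of f C X Y] by blast

context category
begin

lemma isomorphism_inverse:
  assumes "isomorphism C f" "f \<in> Hom C X Y"
  obtains g where "g \<in> Hom C Y X" "g \<cdot> f = Ident C X" "f \<cdot> g = Ident C Y"
  using assms HomD[OF assms(2)] unfolding isomorphism_def by blast

lemma isomorphism_monomorphism:
  assumes "isomorphism C f"
  shows "monomorphism C f"
proof -
  have f: "f \<in> Hom C (Dom C f) (Cod C f)"
    using assms by (simp add: isomorphism_def Hom_def)
  obtain k where k: "k \<in> Hom C (Cod C f) (Dom C f)" "k \<cdot> f = Ident C (Dom C f)"
    using isomorphism_inverse[OF assms f] by blast
  \<comment> \<open>The left inverse \<open>k\<close> recovers \<open>g\<close> from
    \<open>f \<cdot> g\<close>, so equal composites force equal arrows.\<close>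
  have "g = k \<cdot> (f \<cdot> g)" if "g \<in> Hom C X (Dom C f)" for g X
    using Comp_assoc[OF that f k(1)] Ident_left[OF that] k(2) by simp
  then show ?thesis
    using f unfolding monomorphism_def by (metis HomD)
qed

lemma isomorphism_cancel_right:
  assumes "isomorphism C e" "e \<in> Hom C X Y" "f \<in> Hom C Y Z" "g \<in> Hom C Y Z"
    and "f \<cdot> e = g \<cdot> e"
  shows "f = g"
proof -
  obtain k where k: "k \<in> Hom C Y X" "e \<cdot> k = Ident C Y"
    using isomorphism_inverse[OF assms(1,2)] by blast
  have "h = (h \<cdot> e) \<cdot> k" if "h \<in> Hom C Y Z" for h
    using Comp_assoc[OF k(1) assms(2) that] Ident_right[OF that] k(2) by simp
  then show ?thesis
    using assms(3-5) by metis
qed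

text \<open>The identity functor serves in both directions. This is all the theorem needs, since the
  two categories of monoids turn out to be equal.\<close>

lemma isomorphic_categories_refl: "isomorphic_categories C C"
proof -
  have "cat_functor C C identity_functor"
    by unfold_locales (simp_all add: identity_functor_def)
  then show ?thesis
    unfolding isomorphic_categories_def
    by (intro exI[of _ identity_functor]) (simp add: identity_functor_def)
qed

end

section \<open>Tensor and unit laws, rephrased for arrows typed by \<open>Hom\<close>\<close>

context monoidal_category
begin

abbreviation I where "I \<equiv> Unit C"

lemma tensor_obj_in: "X \<in> Obj C \<Longrightarrow> Y \<in> Obj C \<Longrightarrow> X \<odot> Y \<in> Obj C"
  using cat_functor.obj_map_in[OF tensor_functor, of "(X, Y)"]
  by (simp add: product_category_def)

lemma tensor_in:
  "f \<in> Hom C X Y \<Longrightarrow> g \<in> Hom C X' Y' \<Longrightarrow> f \<otimes> g \<in> Hom C (X \<odot> X') (Y \<odot> Y')"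
  using cat_functor.arr_map_in[OF tensor_functor, of "(f, g)" "(X, X')" "(Y, Y')"]
  by (simp add: product_category_def Hom_def)

lemma tensor_Ident:
  "X \<in> Obj C \<Longrightarrow> Y \<in> Obj C \<Longrightarrow> Ident C X \<otimes> Ident C Y = Ident C (X \<odot> Y)"
  using cat_functor.arr_map_Ident[OF tensor_functor, of "(X, Y)"]
  by (simp add: product_category_def)

lemma interchange:
  "f \<in> Hom C X Y \<Longrightarrow> g \<in> Hom C Y Z \<Longrightarrow> f' \<in> Hom C X' Y' \<Longrightarrow> g' \<in> Hom C Y' Z'
    \<Longrightarrow> (g \<otimes> g') \<cdot> (f \<otimes> f') = (g \<cdot> f) \<otimes> (g' \<cdot> f')"
  using cat_functor.arr_map_Comp[OF tensor_functor,
      of "(f, f')" "(X, X')" "(Y, Y')" "(g, g')" "(Z, Z')"]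
  by (simp add: product_category_def Hom_def)

lemma tensor_assoc:
  "f \<in> Hom C X Y \<Longrightarrow> g \<in> Hom C X' Y' \<Longrightarrow> h \<in> Hom C X'' Y''
    \<Longrightarrow> (f \<otimes> g) \<otimes> h = f \<otimes> (g \<otimes> h)"
  by (simp add: tensor_arr_assoc Hom_def)

lemma Lam_in: "X \<in> Obj C \<Longrightarrow> Lam C X \<in> Hom C (I \<odot> X) X"
  using natural_isomorphism.component_in[OF Lam_natural_iso]
  by (simp add: tensor_left_def identity_functor_def)

lemma Rho_in: "X \<in> Obj C \<Longrightarrow> Rho C X \<in> Hom C (X \<odot> I) X"
  using natural_isomorphism.component_in[OF Rho_natural_iso]
  by (simp add: tensor_right_def identity_functor_def)

lemma Lam_natural: "f \<in> Hom C X Y \<Longrightarrow> Lam C Y \<cdot> (I \<triangleright> f) = f \<cdot> Lam C X"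
  using natural_isomorphism.naturality[OF Lam_natural_iso]
  by (simp add: tensor_left_def identity_functor_def)

lemma Rho_natural: "f \<in> Hom C X Y \<Longrightarrow> Rho C Y \<cdot> (f \<triangleleft> I) = f \<cdot> Rho C X"
  using natural_isomorphism.naturality[OF Rho_natural_iso]
  by (simp add: tensor_right_def identity_functor_def)

lemmas Lam_iso = natural_isomorphism.component_iso[OF Lam_natural_iso]
  and Rho_iso = natural_isomorphism.component_iso[OF Rho_natural_iso]

section \<open>Equivalence of the classical and the Saavedra unit conditions\<close>

lemma classical_imp_saavedra:
  assumes "classical_monoid C M \<mu> \<eta>"
  shows "saavedra_monoid C M \<mu> \<eta>"
proof -
  have M: "M \<in> Obj C" and \<mu>: "\<mu> \<in> Hom C (M \<odot> M) M" and \<eta>: "\<eta> \<in> Hom C I M"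
    and semi: "semi_monoid C M \<mu>"
    and left: "\<mu> \<cdot> (\<eta> \<triangleleft> M) = Lam C M" and right: "\<mu> \<cdot> (M \<triangleright> \<eta>) = Rho C M"
    using assms by (auto simp: classical_monoid_def semi_monoid_def)
  \<comment> \<open>Passing through \<open>I \<odot> M\<close> exposes
    \<open>\<eta> \<triangleleft> M\<close>, to which the left unit law applies; naturality of
    \<open>Lam C\<close> at \<open>\<eta>\<close> then yields multiplicativity.\<close>
  have "\<eta> \<otimes> \<eta> = (\<eta> \<triangleleft> M) \<cdot> (I \<triangleright> \<eta>)"
    using interchange[OF Ident_in[OF Unit_in] \<eta> \<eta> Ident_in[OF M]]
    by (simp add: Ident_left[OF \<eta>] Ident_right[OF \<eta>])
  then have "\<mu> \<cdot> (\<eta> \<otimes> \<eta>) = (\<mu> \<cdot> (\<eta> \<triangleleft> M)) \<cdot> (I \<triangleright> \<eta>)"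
    using Comp_assoc[OF tensor_in[OF Ident_in[OF Unit_in] \<eta>] tensor_in[OF \<eta> Ident_in[OF M]] \<mu>]
    by simp
  also have "\<dots> = \<eta> \<cdot> Lam C I"
    using Lam_natural[OF \<eta>] left by simp
  finally have "semi_monoid_hom C I (saavedra_alpha C) M \<mu> \<eta>"
    using semi_monoid_Unit semi \<eta> by (simp add: semi_monoid_hom_def saavedra_alpha_def)
  moreover have "gentle C M \<mu> I \<eta>"
    using Unit_in \<eta> isomorphism_monomorphism[OF Lam_iso[OF M]]
      isomorphism_monomorphism[OF Rho_iso[OF M]]
    by (simp add: gentle_def left right)
  ultimately show ?thesis
    using semi by (simp add: saavedra_monoid_def)
qed

text \<open>The key equation compares the two bracketings of the triple product along
  \<open>\<eta> \<otimes> (\<eta> \<triangleleft> M)\<close>. One bracketing multiplies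
  \<open>M\<close> by the unit twice, the other first multiplies the two units together.\<close>

lemma saavedra_left_unit:
  assumes "saavedra_monoid C M \<mu> \<eta>"
  shows "\<mu> \<cdot> (\<eta> \<triangleleft> M) = Lam C M"
proof -
  have M: "M \<in> Obj C" and \<mu>: "\<mu> \<in> Hom C (M \<odot> M) M" and \<eta>: "\<eta> \<in> Hom C I M"
    and assoc: "\<mu> \<cdot> (\<mu> \<triangleleft> M) = \<mu> \<cdot> (M \<triangleright> \<mu>)"
    and hom: "\<eta> \<cdot> Lam C I = \<mu> \<cdot> (\<eta> \<otimes> \<eta>)"
    and mono: "monomorphism C (\<mu> \<cdot> (\<eta> \<triangleleft> M))"
    using assms
    by (auto simp: saavedra_monoid_def semi_monoid_def semi_monoid_hom_def gentle_def
        saavedra_alpha_def)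
  define f where "f = \<mu> \<cdot> (\<eta> \<triangleleft> M)"
  note idM = Ident_in[OF M] and idI = Ident_in[OF Unit_in]
    and IM = tensor_obj_in[OF Unit_in M]
  note \<alpha> = Lam_in[OF Unit_in] and lam = Lam_in[OF M] and \<eta>M = tensor_in[OF \<eta> idM]
  have f: "f \<in> Hom C (I \<odot> M) M"
    unfolding f_def by (rule Comp_in[OF \<eta>M \<mu>])
  have \<eta>\<eta>M: "\<eta> \<otimes> (\<eta> \<triangleleft> M) \<in> Hom C (I \<odot> I \<odot> M) (M \<odot> M \<odot> M)"
    by (rule tensor_in[OF \<eta> \<eta>M])
  \<comment> \<open>Strict associativity on objects rewrites the domain
    \<open>(M \<odot> M) \<odot> M\<close> so that it matches the codomain of
    \<open>\<eta> \<otimes> (\<eta> \<triangleleft> M)\<close>.\<close>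
  have \<mu>M: "\<mu> \<triangleleft> M \<in> Hom C (M \<odot> M \<odot> M) (M \<odot> M)"
    using tensor_in[OF \<mu> idM] by (simp add: tensor_obj_assoc M)
  have If: "I \<triangleright> f \<in> Hom C (I \<odot> I \<odot> M) (I \<odot> M)"
    by (rule tensor_in[OF idI f])
  have I_lam: "I \<triangleright> Lam C M \<in> Hom C (I \<odot> I \<odot> M) (I \<odot> M)"
    by (rule tensor_in[OF idI lam])
  \<comment> \<open>The middle unit axiom at \<open>I\<close> and \<open>M\<close>, with
    \<open>Lam C I = Rho C I\<close>. It turns the arrow produced by multiplicativity of
    \<open>\<eta>\<close> into one of the form \<open>I \<triangleright> _\<close>, comparable with
    \<open>I \<triangleright> f\<close>.\<close>
  have \<alpha>M: "Lam C I \<triangleleft> M = I \<triangleright> Lam C M"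
    by (simp add: Lam_Rho_middle Lam_Rho_Unit Unit_in M)
  have "f \<cdot> (I \<triangleright> f) = \<mu> \<cdot> ((\<eta> \<triangleleft> M) \<cdot> (I \<triangleright> f))"
    unfolding f_def by (rule Comp_assoc[OF If[unfolded f_def] \<eta>M \<mu>])
  also have "(\<eta> \<triangleleft> M) \<cdot> (I \<triangleright> f) = \<eta> \<otimes> f"
    by (simp add: interchange[OF idI \<eta> f idM] Ident_right[OF \<eta>] Ident_left[OF f])
  also have "\<eta> \<otimes> f = (M \<triangleright> \<mu>) \<cdot> (\<eta> \<otimes> (\<eta> \<triangleleft> M))"
    by (simp add: interchange[OF \<eta> idM \<eta>M \<mu>] Ident_left[OF \<eta>] f_def)
  \<comment> \<open>Here the bracketing changes: from now on the two units are multiplied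
    first.\<close>
  also have "\<mu> \<cdot> \<dots> = (\<mu> \<cdot> (\<mu> \<triangleleft> M)) \<cdot> (\<eta> \<otimes> (\<eta> \<triangleleft> M))"
    by (simp add: assoc Comp_assoc[OF \<eta>\<eta>M tensor_in[OF idM \<mu>] \<mu>])
  also have "\<dots> = \<mu> \<cdot> ((\<mu> \<triangleleft> M) \<cdot> ((\<eta> \<otimes> \<eta>) \<triangleleft> M))"
    by (simp add: tensor_assoc[OF \<eta> \<eta> idM] Comp_assoc[OF \<eta>\<eta>M \<mu>M \<mu>])
  also have "(\<mu> \<triangleleft> M) \<cdot> ((\<eta> \<otimes> \<eta>) \<triangleleft> M) = (\<eta> \<cdot> Lam C I) \<triangleleft> M"
    by (simp add: interchange[OF tensor_in[OF \<eta> \<eta>] \<mu> idM idM] Ident_left[OF idM] hom)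
  also have "\<dots> = (\<eta> \<triangleleft> M) \<cdot> (I \<triangleright> Lam C M)"
    by (simp add: interchange[OF \<alpha> \<eta> idM idM] Ident_left[OF idM] flip: \<alpha>M)
  also have "\<mu> \<cdot> \<dots> = f \<cdot> (I \<triangleright> Lam C M)"
    unfolding f_def by (rule Comp_assoc[OF I_lam \<eta>M \<mu>, symmetric])
  finally have "I \<triangleright> f = I \<triangleright> Lam C M"
    by (rule monomorphism_cancel[OF mono[folded f_def] f If I_lam])
  \<comment> \<open>Naturality of \<open>Lam C\<close> at \<open>f\<close> and at
    \<open>Lam C M\<close> itself rewrites the two sides to
    \<open>Lam C M \<cdot> (I \<triangleright> f)\<close> and
    \<open>Lam C M \<cdot> (I \<triangleright> Lam C M)\<close>.\<close>
  then have "f \<cdot> Lam C (I \<odot> M) = Lam C M \<cdot> Lam C (I \<odot> M)"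
    by (simp flip: Lam_natural[OF f] Lam_natural[OF lam])
  then show ?thesis
    unfolding f_def[symmetric]
    by (rule isomorphism_cancel_right[OF Lam_iso[OF IM] Lam_in[OF IM] f lam])
qed

text \<open>Mirror image of \<open>saavedra_left_unit\<close>: the triple product runs along
  \<open>(M \<triangleright> \<eta>) \<otimes> \<eta>\<close>, and naturality of
  \<open>Rho C\<close> replaces that of \<open>Lam C\<close>.\<close>

lemma saavedra_right_unit:
  assumes "saavedra_monoid C M \<mu> \<eta>"
  shows "\<mu> \<cdot> (M \<triangleright> \<eta>) = Rho C M"
proof -
  have M: "M \<in> Obj C" and \<mu>: "\<mu> \<in> Hom C (M \<odot> M) M" and \<eta>: "\<eta> \<in> Hom C I M"
    and assoc: "\<mu> \<cdot> (\<mu> \<triangleleft> M) = \<mu> \<cdot> (M \<triangleright> \<mu>)"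
    and hom: "\<eta> \<cdot> Lam C I = \<mu> \<cdot> (\<eta> \<otimes> \<eta>)"
    and mono: "monomorphism C (\<mu> \<cdot> (M \<triangleright> \<eta>))"
    using assms
    by (auto simp: saavedra_monoid_def semi_monoid_def semi_monoid_hom_def gentle_def
        saavedra_alpha_def)
  define f where "f = \<mu> \<cdot> (M \<triangleright> \<eta>)"
  note idM = Ident_in[OF M] and idI = Ident_in[OF Unit_in]
    and MI = tensor_obj_in[OF M Unit_in]
  note \<alpha> = Lam_in[OF Unit_in] and \<rho> = Rho_in[OF M] and M\<eta> = tensor_in[OF idM \<eta>]
  have f: "f \<in> Hom C (M \<odot> I) M"
    unfolding f_def by (rule Comp_in[OF M\<eta> \<mu>])
  \<comment> \<open>Only the codomain is reassociated; the domain keeps the bracketing that it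
    shares with \<open>f \<triangleleft> I\<close>.\<close>
  have M\<eta>\<eta>: "(M \<triangleright> \<eta>) \<otimes> \<eta> \<in> Hom C ((M \<odot> I) \<odot> I) (M \<odot> M \<odot> M)"
    using tensor_in[OF M\<eta> \<eta>] by (simp add: tensor_obj_assoc M)
  have \<mu>M: "\<mu> \<triangleleft> M \<in> Hom C (M \<odot> M \<odot> M) (M \<odot> M)"
    using tensor_in[OF \<mu> idM] by (simp add: tensor_obj_assoc M)
  have fI: "f \<triangleleft> I \<in> Hom C ((M \<odot> I) \<odot> I) (M \<odot> I)"
    by (rule tensor_in[OF f idI])
  have \<rho>I: "Rho C M \<triangleleft> I \<in> Hom C ((M \<odot> I) \<odot> I) (M \<odot> I)"
    by (rule tensor_in[OF \<rho> idI])
  \<comment> \<open>The middle unit axiom, now at \<open>M\<close> and \<open>I\<close>.\<close>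
  have M\<alpha>: "M \<triangleright> Lam C I = Rho C M \<triangleleft> I"
    by (simp add: Lam_Rho_middle Unit_in M)
  have "f \<cdot> (f \<triangleleft> I) = \<mu> \<cdot> ((M \<triangleright> \<eta>) \<cdot> (f \<triangleleft> I))"
    unfolding f_def by (rule Comp_assoc[OF fI[unfolded f_def] M\<eta> \<mu>])
  also have "(M \<triangleright> \<eta>) \<cdot> (f \<triangleleft> I) = f \<otimes> \<eta>"
    by (simp add: interchange[OF f idM idI \<eta>] Ident_right[OF \<eta>] Ident_left[OF f])
  also have "f \<otimes> \<eta> = (\<mu> \<triangleleft> M) \<cdot> ((M \<triangleright> \<eta>) \<otimes> \<eta>)"
    by (simp add: interchange[OF M\<eta> \<mu> \<eta> idM] Ident_left[OF \<eta>] f_def)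
  also have "\<mu> \<cdot> \<dots> = (\<mu> \<cdot> (M \<triangleright> \<mu>)) \<cdot> ((M \<triangleright> \<eta>) \<otimes> \<eta>)"
    by (simp add: Comp_assoc[OF M\<eta>\<eta> \<mu>M \<mu>] flip: assoc)
  also have "\<dots> = \<mu> \<cdot> ((M \<triangleright> \<mu>) \<cdot> (M \<triangleright> (\<eta> \<otimes> \<eta>)))"
    by (simp add: Comp_assoc[OF M\<eta>\<eta> tensor_in[OF idM \<mu>] \<mu>] flip: tensor_assoc[OF idM \<eta> \<eta>])
  also have "(M \<triangleright> \<mu>) \<cdot> (M \<triangleright> (\<eta> \<otimes> \<eta>)) = M \<triangleright> (\<eta> \<cdot> Lam C I)"
    by (simp add: interchange[OF idM idM tensor_in[OF \<eta> \<eta>] \<mu>] Ident_left[OF idM] hom)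
  also have "\<dots> = (M \<triangleright> \<eta>) \<cdot> (Rho C M \<triangleleft> I)"
    by (simp add: interchange[OF idM idM \<alpha> \<eta>] Ident_left[OF idM] flip: M\<alpha>)
  also have "\<mu> \<cdot> \<dots> = f \<cdot> (Rho C M \<triangleleft> I)"
    unfolding f_def by (rule Comp_assoc[OF \<rho>I M\<eta> \<mu>, symmetric])
  finally have "f \<triangleleft> I = Rho C M \<triangleleft> I"
    by (rule monomorphism_cancel[OF mono[folded f_def] f fI \<rho>I])
  then have "f \<cdot> Rho C (M \<odot> I) = Rho C M \<cdot> Rho C (M \<odot> I)"
    by (simp flip: Rho_natural[OF f] Rho_natural[OF \<rho>])
  then show ?thesis
    unfolding f_def[symmetric]
    by (rule isomorphism_cancel_right[OF Rho_iso[OF MI] Rho_in[OF MI] f \<rho>])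
qed

lemma classical_iff_saavedra: "classical_monoid C M \<mu> \<eta> \<longleftrightarrow> saavedra_monoid C M \<mu> \<eta>"
proof
  assume saavedra: "saavedra_monoid C M \<mu> \<eta>"
  then show "classical_monoid C M \<mu> \<eta>"
    \<comment> \<open>Unfolding \<open>gentle_def\<close> supplies the type of
      \<open>\<eta>\<close>.\<close>
    using saavedra_left_unit[OF saavedra] saavedra_right_unit[OF saavedra]
    by (simp add: classical_monoid_def saavedra_monoid_def gentle_def)
qed (rule classical_imp_saavedra)

section \<open>Monoids and their homomorphisms as a category\<close>

lemma monoid_hom_Ident:
  assumes "semi_monoid C M \<mu>" "\<eta> \<in> Hom C I M"
  shows "monoid_hom C (M, \<mu>, \<eta>) (M, \<mu>, \<eta>) (Ident C M)"
proof -
  have M: "M \<in> Obj C" and \<mu>: "\<mu> \<in> Hom C (M \<odot> M) M"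
    using assms(1) by (auto simp: semi_monoid_def)
  show ?thesis
    by (simp add: monoid_hom_def semi_monoid_hom_def assms(1) Ident_in[OF M] tensor_Ident[OF M M]
        Ident_left[OF \<mu>] Ident_right[OF \<mu>] Ident_left[OF assms(2)])
qed

lemma monoid_hom_Comp:
  assumes \<phi>: "monoid_hom C (M, \<mu>, \<eta>) (M', \<mu>', \<eta>') \<phi>"
    and \<psi>: "monoid_hom C (M', \<mu>', \<eta>') (M'', \<mu>'', \<eta>'') \<psi>"
    and \<eta>: "\<eta> \<in> Hom C I M"
  shows "monoid_hom C (M, \<mu>, \<eta>) (M'', \<mu>'', \<eta>'') (\<psi> \<cdot> \<phi>)"
proof -
  have \<mu>: "\<mu> \<in> Hom C (M \<odot> M) M" "\<mu>' \<in> Hom C (M' \<odot> M') M'" "\<mu>'' \<in> Hom C (M'' \<odot> M'') M''"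
    and semi: "semi_monoid C M \<mu>" "semi_monoid C M'' \<mu>''"
    and h: "\<phi> \<in> Hom C M M'" "\<psi> \<in> Hom C M' M''"
    and mult: "\<phi> \<cdot> \<mu> = \<mu>' \<cdot> (\<phi> \<otimes> \<phi>)" "\<psi> \<cdot> \<mu>' = \<mu>'' \<cdot> (\<psi> \<otimes> \<psi>)"
    and unit: "\<phi> \<cdot> \<eta> = \<eta>'" "\<psi> \<cdot> \<eta>' = \<eta>''"
    using \<phi> \<psi> by (auto simp: monoid_hom_def semi_monoid_hom_def semi_monoid_def)
  have "(\<psi> \<cdot> \<phi>) \<cdot> \<mu> = (\<psi> \<cdot> \<mu>') \<cdot> (\<phi> \<otimes> \<phi>)"
    by (simp add: Comp_assoc[OF \<mu>(1) h] Comp_assoc[OF tensor_in[OF h(1) h(1)] \<mu>(2) h(2)] mult(1))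
  also have "\<dots> = \<mu>'' \<cdot> ((\<psi> \<cdot> \<phi>) \<otimes> (\<psi> \<cdot> \<phi>))"
    by (simp add: mult(2) Comp_assoc[OF tensor_in[OF h(1) h(1)] tensor_in[OF h(2) h(2)] \<mu>(3)]
        interchange[OF h h])
  finally show ?thesis
    using semi Comp_in[OF h] unit
    by (simp add: monoid_hom_def semi_monoid_hom_def Comp_assoc[OF \<eta> h])
qed

lemma monoid_hom_in: "monoid_hom C A B \<psi> \<Longrightarrow> \<psi> \<in> Hom C (fst A) (fst B)"
  by (auto simp: monoid_hom_def semi_monoid_hom_def split: prod.splits)

text \<open>The laws are inherited from \<open>C\<close>, because arrows compose through their
  middle component. The set of triples is left general: typing and associativity suffice, whichever
  unit condition selects the monoids.\<close>

lemma category_category_of_monoids: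
  assumes "\<And>M \<mu> \<eta>. (M, \<mu>, \<eta>) \<in> \<M> \<Longrightarrow> semi_monoid C M \<mu> \<and> \<eta> \<in> Hom C I M"
  shows "category (category_of_monoids C \<M>)" (is "category ?D")
proof -
  have Obj: "Obj ?D = \<M>"
    and Comp: "\<And>A B B' E \<phi> \<psi>. (B', \<psi>, E) \<cdot>\<^bsub>?D\<^esub> (A, \<phi>, B) = (A, \<psi> \<cdot> \<phi>, E)"
    and Ident: "\<And>A. Ident ?D A = (A, Ident C (fst A), A)"
    by (auto simp: category_of_monoids_def split: prod.splits)
  have Hom_iff: "f \<in> Hom ?D A B \<longleftrightarrow> A \<in> \<M> \<and> B \<in> \<M> \<and> (\<exists>\<psi>. f = (A, \<psi>, B) \<and> monoid_hom C A B \<psi>)"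
    for f A B
    by (auto simp: category_of_monoids_def Hom_def)
  \<comment> \<open>For the identity and associativity laws it is enough to remember the type of the
    underlying arrow of \<open>C\<close>.\<close>
  have homE: "\<exists>\<psi>. f = (A, \<psi>, B) \<and> \<psi> \<in> Hom C (fst A) (fst B)" if "f \<in> Hom ?D A B" for f A B
    using that monoid_hom_in unfolding Hom_iff by blast
  show ?thesis
  proof
    show "Dom ?D f \<in> Obj ?D" "Cod ?D f \<in> Obj ?D" if "f \<in> Arr ?D" for f
      using that by (auto simp: category_of_monoids_def)
    show "Ident ?D A \<in> Hom ?D A A" if "A \<in> Obj ?D" for A
      using that assms monoid_hom_Ident
      by (cases A) (simp add: Hom_iff Obj Ident)
    show "g \<cdot>\<^bsub>?D\<^esub> f \<in> Hom ?D A E" if f: "f \<in> Hom ?D A B" and g: "g \<in> Hom ?D B E" for f g A B E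
    proof -
      obtain \<phi> \<psi> where "f = (A, \<phi>, B)" "g = (B, \<psi>, E)" "A \<in> \<M>" "E \<in> \<M>"
        and hom: "monoid_hom C A B \<phi>" "monoid_hom C B E \<psi>"
        using f g unfolding Hom_iff by blast
      moreover have "monoid_hom C A E (\<psi> \<cdot> \<phi>)"
        using hom assms \<open>A \<in> \<M>\<close> by (cases A; cases B; cases E) (simp add: monoid_hom_Comp)
      ultimately show ?thesis
        by (simp add: Hom_iff Comp)
    qed
    show "Ident ?D B \<cdot>\<^bsub>?D\<^esub> f = f" "f \<cdot>\<^bsub>?D\<^esub> Ident ?D A = f" if "f \<in> Hom ?D A B" for f A B
      using homE[OF that] by (auto simp: Ident Comp Ident_left Ident_right)
    show "(h \<cdot>\<^bsub>?D\<^esub> g) \<cdot>\<^bsub>?D\<^esub> f = h \<cdot>\<^bsub>?D\<^esub> g \<cdot>\<^bsub>?D\<^esub> f"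
      if "f \<in> Hom ?D W X" "g \<in> Hom ?D X Y" "h \<in> Hom ?D Y Z" for f g h W X Y Z
      using homE[OF that(1)] homE[OF that(2)] homE[OF that(3)] by (auto simp: Comp Comp_assoc)
  qed
qed

end

theorem proposition4p5:
  fixes C :: "('o, 'a) moncat"
  assumes "monoidal_category C"
  shows "isomorphic_categories (classical_monoids C) (saavedra_monoids C)"
proof -
  interpret monoidal_category C by fact
  have "category (classical_monoids C)"
    unfolding classical_monoids_def
    by (rule category_category_of_monoids) (simp add: classical_monoid_def)
  moreover have "saavedra_monoids C = classical_monoids C"
    by (simp add: saavedra_monoids_def classical_monoids_def classical_iff_saavedra)
  ultimately show ?thesis
    by (simp add: category.isomorphic_categories_refl)
qed

end
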